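(* Fix a prompt context $z$, a finite horizon $T$, and a finite vocabulary $\mathcal{V}$. Let $p_{\theta_0}$ be a frozen autoregressive model that is strictly positive. Then the trajectory energy $$E_z(\tau)=-\sum_{i=1}^T \log p_{\theta_0}(\tau_i\mid z,\tau_{<i}),\qquad \tau=(\tau_1,\dots,\tau_T)\in\mathcal{V}^T,$$ has a Gibbs distribution equal to the model's autoregressive distribution over continuations: $$\frac{\exp(-E_z(\tau))}{\sum_{\tau'\in\mathcal{V}^T}\exp(-E_z(\tau'))}=p_{\theta_0}(\tau\mid z)\qquad\text{for all }\tau\in\mathcal{V}^T.$$ Conversely, any additive energy $E_z(\tau)=\sum_{i=1}^T c_z(s_i,a_i)$, $\tau=(a_1,\dots,a_T)$, on the finite generation tree (with real-valued local costs $c_z$) induces the normalized next-token policy $$p_E(a_i\mid z,a_{<i})=\exp\!\left(-c_z(s_i,a_i)+V_z(s_{i+1})-V_z(s_i)\right),\qquad i=1,\dots,T,$$ where $s_i=(z,a_{<i})$ and $V_z$ is the log-partition soft value over suffix continuations.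
   Context: A trajectory (continuation) is a sequence $\tau=(a_1,\dots,a_T)\in\mathcal{V}^T$, and $a_{<i}=(a_1,\dots,a_{i-1})$. Variable-length generation is handled by including an end-of-sequence token and padding to the horizon $T$. The state at depth $i$ is $s_i=(z,a_{<i})$. The finite generation tree is the tree of all such states, with the action $a_i\in\mathcal{V}$ leading from $s_i$ to $s_{i+1}=(z,a_1,\dots,a_i)$. An autoregressive model assigns to each state a probability distribution over $\mathcal{V}$ for the next token, and $p_{\theta_0}(\tau\mid z)=\prod_{i=1}^T p_{\theta_0}(\tau_i\mid z,\tau_{<i})$. Strictly positive means that all next-token probabilities are $>0$. The log-partition soft value is $$V_z(s_i)=\log\sum_{a_i,\dots,a_T\in\mathcal{V}}\exp\!\Big(-\sum_{j=i}^T c_z(s_j,a_j)\Big)\quad (1\le i\le T),\qquad V_z(s_{T+1})=0.$$ The next-token policy induced by an additive energy $E_z$ is the family of conditional distributions of the next token $a_i$ given $(z,a_{<i})$ under the Gibbs distribution on $\mathcal{V}^T$ proportional to $\exp(-E_z(\tau))$. Normalized means that these conditionals sum to one over $a_i\in\mathcal{V}$. *)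

theory Defs
  imports "HOL-Probability.Probability"
begin

text \<open>
  The vocabulary is a finite type \<open>'v\<close>. A state is a prompt together with the list of tokens
  generated so far. List indices start at 0: \<open>\<tau> ! i\<close> is the token \<open>a\<^sub>i\<^sub>+\<^sub>1\<close> and
  \<open>(z, take i \<tau>)\<close> is the state \<open>s\<^sub>i\<^sub>+\<^sub>1\<close> in which it is chosen, so a state \<open>(z, h)\<close> has depth
  \<open>length h + 1\<close>.
\<close>

type_synonym ('z, 'v) state = "'z \<times> 'v list"

type_synonym ('z, 'v) model = "('z, 'v) state \<Rightarrow> 'v pmf"

type_synonym ('z, 'v) cost = "('z, 'v) state \<Rightarrow> 'v \<Rightarrow> real"

definition trajectories :: "nat \<Rightarrow> 'v list set" where
  "trajectories T = {\<tau>. length \<tau> = T}"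

lemma finite_trajectories [simp]: "finite (trajectories T :: 'v::finite list set)"
  using finite_lists_length_eq[of "UNIV :: 'v set" T] by (simp add: trajectories_def)

lemma trajectories_nonempty [simp]: "trajectories T \<noteq> {}"
proof -
  have "replicate T undefined \<in> trajectories T"
    by (simp add: trajectories_def)
  then show ?thesis by blast
qed

text \<open>A token is chosen only at the non-terminal states of the tree rooted at \<open>z\<close>.\<close>

definition strictly_positive :: "('z, 'v) model \<Rightarrow> 'z \<Rightarrow> nat \<Rightarrow> bool" where
  "strictly_positive p z T \<longleftrightarrow> (\<forall>h a. length h < T \<longrightarrow> pmf (p (z, h)) a > 0)"

definition trajectory_prob :: "('z, 'v) model \<Rightarrow> 'z \<Rightarrow> nat \<Rightarrow> 'v list \<Rightarrow> real" where
  "trajectory_prob p z T \<tau> = (\<Prod>i<T. pmf (p (z, take i \<tau>)) (\<tau> ! i))"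

definition model_energy :: "('z, 'v) model \<Rightarrow> 'z \<Rightarrow> nat \<Rightarrow> 'v list \<Rightarrow> real" where
  "model_energy p z T \<tau> = - (\<Sum>i<T. ln (pmf (p (z, take i \<tau>)) (\<tau> ! i)))"

definition additive_energy :: "('z, 'v) cost \<Rightarrow> 'z \<Rightarrow> nat \<Rightarrow> 'v list \<Rightarrow> real" where
  "additive_energy c z T \<tau> = (\<Sum>i<T. c (z, take i \<tau>) (\<tau> ! i))"

definition gibbs_prob :: "nat \<Rightarrow> ('v list \<Rightarrow> real) \<Rightarrow> 'v list \<Rightarrow> real" where
  "gibbs_prob T E \<tau> = exp (- E \<tau>) / (\<Sum>\<tau>'\<in>trajectories T. exp (- E \<tau>'))"

definition gibbs_pmf :: "nat \<Rightarrow> ('v list \<Rightarrow> real) \<Rightarrow> 'v list pmf" where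
  "gibbs_pmf T E = embed_pmf (\<lambda>\<tau>. if \<tau> \<in> trajectories T then gibbs_prob T E \<tau> else 0)"

text \<open>\<^const>\<open>embed_pmf\<close> is meaningful only for a probability mass function, which this one is.\<close>

lemma pmf_gibbs_pmf:
  fixes E :: "'v::finite list \<Rightarrow> real"
  shows "pmf (gibbs_pmf T E) \<tau> = (if \<tau> \<in> trajectories T then gibbs_prob T E \<tau> else 0)"
  unfolding gibbs_pmf_def
proof (rule pmf_embed_pmf)
  let ?f = "\<lambda>\<tau>. if \<tau> \<in> trajectories T then gibbs_prob T E \<tau> else 0"
  let ?Z = "\<Sum>\<tau>\<in>trajectories T. exp (- E \<tau>)"
  have Z: "?Z > 0"
    by (intro sum_pos) auto
  then show nonneg: "0 \<le> ?f x" for x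
    by (simp add: gibbs_prob_def)
  have "(\<integral>\<^sup>+x. ennreal (?f x) \<partial>count_space UNIV)
      = (\<integral>\<^sup>+x. ennreal (?f x) \<partial>count_space (trajectories T))"
    by (rule nn_integral_count_space_eq) auto
  also have "\<dots> = (\<Sum>x\<in>trajectories T. ennreal (?f x))"
    by (rule nn_integral_count_space_finite) simp
  also have "\<dots> = ennreal (\<Sum>x\<in>trajectories T. ?f x)"
    by (rule sum_ennreal[OF nonneg])
  also have "(\<Sum>x\<in>trajectories T. ?f x) = (\<Sum>x\<in>trajectories T. exp (- E x) / ?Z)"
    by (intro sum.cong) (simp_all add: gibbs_prob_def)
  also have "\<dots> = 1"
    using Z by (simp add: sum_divide_distrib[symmetric])
  finally show "(\<integral>\<^sup>+x. ennreal (?f x) \<partial>count_space UNIV) = 1"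
    by simp
qed

definition next_token_policy :: "nat \<Rightarrow> ('v list \<Rightarrow> real) \<Rightarrow> 'v list \<Rightarrow> 'v \<Rightarrow> real" where
  "next_token_policy T E h a =
     \<P>(\<tau> in gibbs_pmf T E. \<tau> ! length h = a \<bar> take (length h) \<tau> = h)"

fun soft_value :: "('z, 'v) cost \<Rightarrow> nat \<Rightarrow> ('z, 'v) state \<Rightarrow> real" where
  "soft_value c T (z, h) =
     (if length h < T
      then ln (\<Sum>w\<in>trajectories (T - length h).
                 exp (- (\<Sum>j<T - length h. c (z, h @ take j w) (w ! j))))
      else 0)"

end

theory Submission imports Defs
begin

text \<open>
  The Gibbs mass of the subtree below a prefix \<open>h\<close> is
  \<open>exp (- energy of h) * suffix_partition h / Z\<close>. The policy is the ratio of two such masses, in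
  which the normalizing constant \<open>Z\<close> and the energy of \<open>h\<close> cancel.
\<close>

text \<open>The last token is split off, not the first: appending leaves all earlier states
  unchanged, so the last conditional distribution can be summed out first.\<close>

lemma sum_trajectories_Suc:
  fixes f :: "'v::finite list \<Rightarrow> real"
  shows "(\<Sum>\<tau>\<in>trajectories (Suc T). f \<tau>) = (\<Sum>\<tau>\<in>trajectories T. \<Sum>a\<in>UNIV. f (\<tau> @ [a]))"
proof -
  have "(\<Sum>\<tau>\<in>trajectories (Suc T). f \<tau>) = (\<Sum>(\<tau>, a)\<in>trajectories T \<times> UNIV. f (\<tau> @ [a]))"
    by (rule sum.reindex_bij_witness[where i = "\<lambda>(\<tau>, a). \<tau> @ [a]"
          and j = "\<lambda>\<tau>. (butlast \<tau>, last \<tau>)"])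
       (auto simp: trajectories_def length_Suc_conv_rev)
  then show ?thesis
    by (simp add: sum.cartesian_product)
qed

lemma trajectory_prob_snoc:
  assumes "\<tau> \<in> trajectories T"
  shows "trajectory_prob p z (Suc T) (\<tau> @ [a]) = trajectory_prob p z T \<tau> * pmf (p (z, \<tau>)) a"
  using assms by (simp add: trajectory_prob_def trajectories_def nth_append)

text \<open>Each \<open>p (z, \<tau>)\<close> has total mass one, so summing over the last token
  removes the last factor. This makes the partition function of the model energy equal to 1.\<close>

lemma sum_trajectory_prob:
  fixes p :: "('z, 'v::finite) model"
  shows "(\<Sum>\<tau>\<in>trajectories T. trajectory_prob p z T \<tau>) = 1"
proof (induction T)
  case 0
  then show ?case
    by (simp add: trajectories_def trajectory_prob_def)
next
  case (Suc T)
  then show ?case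
    by (simp add: sum_trajectories_Suc trajectory_prob_snoc sum_distrib_left[symmetric] sum_pmf_eq_1)
qed

lemma exp_model_energy:
  assumes "strictly_positive p z T" "\<tau> \<in> trajectories T"
  shows "exp (- model_energy p z T \<tau>) = trajectory_prob p z T \<tau>"
  \<comment> \<open>Along a trajectory the prefix \<open>take i \<tau>\<close> has length
    \<open>i < T\<close>, so strict positivity applies to each factor and \<open>exp\<close> undoes
    \<open>ln\<close>.\<close>
  unfolding model_energy_def trajectory_prob_def minus_minus exp_sum[OF finite_lessThan]
  using assms by (intro prod.cong) (auto simp: strictly_positive_def trajectories_def)

text \<open>The argument of \<open>ln\<close> in \<open>soft_value\<close>, without the case split:
  at a leaf the only suffix is \<open>[]\<close> and the sum is 1, matching the soft value
  0.\<close>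

definition suffix_partition :: "('z, 'v::finite) cost \<Rightarrow> nat \<Rightarrow> 'z \<Rightarrow> 'v list \<Rightarrow> real" where
  "suffix_partition c T z h =
     (\<Sum>w\<in>trajectories (T - length h).
        exp (- (\<Sum>j<T - length h. c (z, h @ take j w) (w ! j))))"

lemma suffix_partition_pos: "suffix_partition c T z h > 0"
  unfolding suffix_partition_def by (intro sum_pos) auto

lemma exp_soft_value:
  assumes "length h \<le> T"
  shows "exp (soft_value c T (z, h)) = suffix_partition c T z h"
proof (cases "length h < T")
  case True
  then show ?thesis
    using suffix_partition_pos[of c T z h] by (simp add: suffix_partition_def)
next
  case False
  with assms show ?thesis
    by (simp add: suffix_partition_def trajectories_def)
qed

text \<open>The first \<open>length h\<close> costs do not see \<open>w\<close>; the later ones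
  start from \<open>(z, h)\<close>. The induction keeps \<open>w\<close> fixed and counts one more
  cost per step.\<close>

lemma additive_energy_append:
  "additive_energy c z (length h + m) (h @ w) =
     additive_energy c z (length h) h + (\<Sum>j<m. c (z, h @ take j w) (w ! j))"
proof (induction m)
  case 0
  then show ?case
    by (simp add: additive_energy_def nth_append)
next
  case (Suc m)
  then show ?case
    by (simp add: additive_energy_def)
qed

lemma sum_trajectories_prefix:
  fixes f :: "'v::finite list \<Rightarrow> real"
  assumes "length h \<le> T"
  shows "(\<Sum>\<tau> | \<tau> \<in> trajectories T \<and> take (length h) \<tau> = h. f \<tau>) =
           (\<Sum>w\<in>trajectories (T - length h). f (h @ w))"
  by (rule sum.reindex_bij_witness[where i = "\<lambda>w. h @ w" and j = "drop (length h)"])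
     (use assms in \<open>auto simp: trajectories_def, (metis append_take_drop_id)+\<close>)

lemma prob_gibbs_pmf:
  fixes E :: "'v::finite list \<Rightarrow> real"
  shows "measure (gibbs_pmf T E) {\<tau>. P \<tau>} = (\<Sum>\<tau> | \<tau> \<in> trajectories T \<and> P \<tau>. gibbs_prob T E \<tau>)"
proof -
  have "set_pmf (gibbs_pmf T E) \<subseteq> trajectories T"
    by (auto simp: set_pmf_eq pmf_gibbs_pmf)
  \<comment> \<open>The event may be infinite, so it is first cut down to the finite set of
    trajectories, which carries all the mass.\<close>
  then have "measure (gibbs_pmf T E) {\<tau>. P \<tau>}
      = measure (gibbs_pmf T E) {\<tau>. \<tau> \<in> trajectories T \<and> P \<tau>}"
    by (intro measure_prob_cong_0) (auto simp: set_pmf_eq)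
  also have "\<dots> = (\<Sum>\<tau> | \<tau> \<in> trajectories T \<and> P \<tau>. gibbs_prob T E \<tau>)"
    by (subst measure_measure_pmf_finite) (auto simp: pmf_gibbs_pmf)
  finally show ?thesis .
qed

lemma prob_gibbs_prefix:
  assumes "length h \<le> T"
  shows "measure (gibbs_pmf T (additive_energy c z T)) {\<tau>. take (length h) \<tau> = h} =
           exp (- additive_energy c z (length h) h) * suffix_partition c T z h
             / (\<Sum>\<tau>\<in>trajectories T. exp (- additive_energy c z T \<tau>))"
proof -
  have "exp (- additive_energy c z T (h @ w)) = exp (- additive_energy c z (length h) h)
      * exp (- (\<Sum>j<T - length h. c (z, h @ take j w) (w ! j)))" for w
    using additive_energy_append[of c z h "T - length h" w] assms
    by (simp add: exp_add[symmetric])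
  then show ?thesis
    by (simp add: prob_gibbs_pmf sum_trajectories_prefix[OF assms] gibbs_prob_def
        suffix_partition_def sum_distrib_left sum_divide_distrib)
qed

lemma next_token_policy_eq:
  fixes E :: "'v::finite list \<Rightarrow> real"
  assumes "length h < T"
  shows "next_token_policy T E h a =
           measure (gibbs_pmf T E) {\<tau>. take (length (h @ [a])) \<tau> = h @ [a]}
             / measure (gibbs_pmf T E) {\<tau>. take (length h) \<tau> = h}"
proof -
  \<comment> \<open>Restricting to trajectories matters: on a list as short as \<open>h\<close>,
    \<open>\<tau> ! length h\<close> is out of range and could happen to equal
    \<open>a\<close>.\<close>
  have "{\<tau> \<in> trajectories T. \<tau> ! length h = a \<and> take (length h) \<tau> = h} =
      {\<tau> \<in> trajectories T. take (length (h @ [a])) \<tau> = h @ [a]}"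
    using assms by (auto simp: trajectories_def take_Suc_conv_app_nth)
  then show ?thesis
    by (simp only: next_token_policy_def cond_prob_def prob_gibbs_pmf space_measure_pmf UNIV_I
        simp_thms)
qed

lemma next_token_policy_additive:
  fixes c :: "('z, 'v::finite) cost"
  assumes "length h < T"
  shows "next_token_policy T (additive_energy c z T) h a =
           exp (- c (z, h) a + soft_value c T (z, h @ [a]) - soft_value c T (z, h))"
proof -
  have Z: "(\<Sum>\<tau>\<in>trajectories T. exp (- additive_energy c z T \<tau>)) > 0"
    by (intro sum_pos) auto
  have snoc: "additive_energy c z (length (h @ [a])) (h @ [a]) =
      additive_energy c z (length h) h + c (z, h) a"
    using additive_energy_append[of c z h 1 "[a]"] by simp
  have "exp (- c (z, h) a + soft_value c T (z, h @ [a]) - soft_value c T (z, h)) =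
      exp (- c (z, h) a) * suffix_partition c T z (h @ [a]) / suffix_partition c T z h"
    using assms exp_soft_value[of "h @ [a]" T c z] exp_soft_value[of h T c z]
    by (simp only: exp_add exp_diff) simp
  moreover have "exp (- additive_energy c z (length (h @ [a])) (h @ [a])) =
      exp (- additive_energy c z (length h) h) * exp (- c (z, h) a)"
    by (simp only: snoc minus_add_distrib exp_add)
  \<comment> \<open>The child may be a leaf, which is why the prefix formula is stated with a
    non-strict bound.\<close>
  moreover have "length (h @ [a]) \<le> T"
    using assms by simp
  ultimately show ?thesis
    using Z assms
    by (simp only: next_token_policy_eq prob_gibbs_prefix less_imp_le) (simp add: field_simps)
qed

text \<open>The token at position \<open>length h\<close> partitions the trajectories through
  \<open>h\<close>, so the numerators add up to the common denominator.\<close>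

lemma sum_next_token_policy:
  fixes E :: "'v::finite list \<Rightarrow> real"
  assumes "length h \<le> T"
  shows "(\<Sum>a\<in>UNIV. next_token_policy T E h a) = 1"
proof -
  let ?S = "{\<tau>. \<tau> \<in> trajectories T \<and> take (length h) \<tau> = h}"
  have fin: "finite ?S"
    by simp
  have Z: "(\<Sum>\<tau>\<in>trajectories T. exp (- E \<tau>)) > 0"
    by (intro sum_pos) auto
  \<comment> \<open>Padding \<open>h\<close> to length \<open>T\<close> with an arbitrary token
    shows that the conditioning event is nonempty, hence has positive mass and the division is by a
    nonzero number.\<close>
  have "h @ replicate (T - length h) undefined \<in> ?S"
    using assms by (simp add: trajectories_def)
  with fin Z have pos: "(\<Sum>\<tau>\<in>?S. gibbs_prob T E \<tau>) > 0"
    by (intro sum_pos) (auto simp: gibbs_prob_def)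
  have "(\<Sum>a\<in>UNIV. next_token_policy T E h a) =
      (\<Sum>a\<in>UNIV. \<Sum>\<tau> | \<tau> \<in> ?S \<and> \<tau> ! length h = a. gibbs_prob T E \<tau>)
        / (\<Sum>\<tau>\<in>?S. gibbs_prob T E \<tau>)"
    by (simp add: next_token_policy_def cond_prob_def prob_gibbs_pmf sum_divide_distrib conj_ac)
  also have "(\<Sum>a\<in>UNIV. \<Sum>\<tau> | \<tau> \<in> ?S \<and> \<tau> ! length h = a. gibbs_prob T E \<tau>) =
      (\<Sum>\<tau>\<in>?S. gibbs_prob T E \<tau>)"
    using fin by (intro sum.group) auto
  finally show ?thesis
    using pos by simp
qed

theorem proposition3p1:
  fixes p :: "('z, 'v::finite) model" and z :: 'z and T :: nat
  shows "(strictly_positive p z T \<longrightarrow>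
            (\<forall>\<tau>\<in>trajectories T.
               exp (- model_energy p z T \<tau>)
                 / (\<Sum>\<tau>'\<in>trajectories T. exp (- model_energy p z T \<tau>'))
               = trajectory_prob p z T \<tau>))
       \<and> (\<forall>c :: ('z, 'v) cost. \<forall>h. length h < T \<longrightarrow>
            (\<forall>a. next_token_policy T (additive_energy c z T) h a
                 = exp (- c (z, h) a + soft_value c T (z, h @ [a]) - soft_value c T (z, h)))
            \<and> (\<Sum>a\<in>UNIV. next_token_policy T (additive_energy c z T) h a) = 1)"
proof (intro conjI impI allI ballI)
  assume pos: "strictly_positive p z T"
  fix \<tau> :: "'v list"
  assume "\<tau> \<in> trajectories T"
  \<comment> \<open>The quotient becomes the trajectory probability divided by the total mass
    1.\<close>
  with pos show "exp (- model_energy p z T \<tau>)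
      / (\<Sum>\<tau>'\<in>trajectories T. exp (- model_energy p z T \<tau>')) = trajectory_prob p z T \<tau>"
    by (simp add: exp_model_energy sum_trajectory_prob)
qed (rule next_token_policy_additive sum_next_token_policy, simp)+

end
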